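(* Let $\mathbb T$ be a geometric theory over a signature $\Sigma$. Then $\mathbb T$ is equivalent to a coherent theory if and only if for any coherent formula-in-context $\{\vec{x}. \phi\}$ over $\Sigma$ and any family $\{\psi_{i}(\vec{x}) \mid i\in I\}$ of geometric formulae in the same context, if the sequent $\phi \vdash_{\vec{x}} \bigvee_{i\in I} \psi_{i}$ is provable in $\mathbb T$ then the sequent $\phi \vdash_{\vec{x}} \bigvee_{i\in I'} \psi_{i}$ is provable in $\mathbb T$ for some finite subset $I'$ of $I$.
   Context: Geometric formulae over a first-order (many-sorted) signature $\Sigma$ are built from atomic formulae (including equalities) using $\top$, finite conjunctions, arbitrary set-indexed disjunctions (including $\bot$) and existential quantification, with finitely many free variables; coherent formulae are those built using only finite disjunctions (including $\bot$). A formula-in-context $\{\vec{x}.\phi\}$ is a formula with a finite list of distinct variables containing its free variables. A geometric (coherent) theory is a set of sequents $\phi\vdash_{\vec{x}}\psi$ between geometric (coherent) formulae; "provable in $\mathbb T$" means derivable from $\mathbb T$ in geometric logic. "$\mathbb T$ is equivalent to a coherent theory" means that $\mathbb T$ can be axiomatized by coherent sequents over $\Sigma$, i.e. there is a set of coherent sequents over $\Sigma$ proving the same geometric sequents as $\mathbb T$. *)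

theory Defs
  imports Main
begin

text \<open>
  Many-sorted first-order signatures. A symbol of type \<open>'f\<close> or \<open>'r\<close> belongs to the signature iff
  it has an arity; thus signatures without sorts, function symbols or relation symbols are allowed.
\<close>

record ('s, 'f, 'r) signature =
  sorts :: "'s set"
  fun_arity :: "'f \<Rightarrow> ('s list \<times> 's) option"
  rel_arity :: "'r \<Rightarrow> 's list option"

definition is_signature :: "('s, 'f, 'r) signature \<Rightarrow> bool" where
  "is_signature \<Sigma> \<longleftrightarrow>
     (\<forall>f ss s. fun_arity \<Sigma> f = Some (ss, s) \<longrightarrow> set ss \<subseteq> sorts \<Sigma> \<and> s \<in> sorts \<Sigma>) \<and>
     (\<forall>R ss. rel_arity \<Sigma> R = Some ss \<longrightarrow> set ss \<subseteq> sorts \<Sigma>)"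

text \<open>
  Variables are de Bruijn indices. A context \<open>x\<^sub>0 : s\<^sub>0, \<dots>, x\<^sub>n : s\<^sub>n\<close> of distinct variables is the list
  \<open>[s\<^sub>0, \<dots>, s\<^sub>n]\<close> of their sorts, and \<open>Var i\<close> is its \<open>i\<close>-th variable. In \<open>Ex s \<phi>\<close> the bound variable,
  of sort \<open>s\<close>, is \<open>Var 0\<close> of \<open>\<phi>\<close>.

  \<open>Disj I \<psi>\<close> is the disjunction of the \<open>\<psi> i\<close> for \<open>i \<in> I\<close>; the values of \<open>\<psi>\<close> outside \<open>I\<close> are irrelevant.
  The type \<open>'i\<close> plays the role of the universe of indices: all its subsets may index disjunctions.
  Bottom is the case \<open>I = {}\<close>. Disjunctions of all finite sizes exist when \<open>'i\<close> is infinite.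
\<close>

datatype 'f tm = Var nat | Fn 'f "'f tm list"

datatype ('i, 's, 'f, 'r) fm =
    Rel 'r "'f tm list"
  | Eq "'f tm" "'f tm"
  | Top
  | And "('i, 's, 'f, 'r) fm" "('i, 's, 'f, 'r) fm"
  | Disj "'i set" "'i \<Rightarrow> ('i, 's, 'f, 'r) fm"
  | Ex 's "('i, 's, 'f, 'r) fm"

inductive has_sort :: "('s, 'f, 'r) signature \<Rightarrow> 's list \<Rightarrow> 'f tm \<Rightarrow> 's \<Rightarrow> bool"
  for \<Sigma> :: "('s, 'f, 'r) signature" and \<Gamma> :: "'s list" where
  Var: "i < length \<Gamma> \<Longrightarrow> has_sort \<Sigma> \<Gamma> (Var i) (\<Gamma> ! i)"
| Fn: "fun_arity \<Sigma> f = Some (ss, s) \<Longrightarrow> list_all2 (has_sort \<Sigma> \<Gamma>) ts ss \<Longrightarrow>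
    has_sort \<Sigma> \<Gamma> (Fn f ts) s"

primrec well_formed ::
  "('s, 'f, 'r) signature \<Rightarrow> 's list \<Rightarrow> ('i, 's, 'f, 'r) fm \<Rightarrow> bool" where
  "well_formed \<Sigma> \<Gamma> (Rel R ts) \<longleftrightarrow>
     (\<exists>ss. rel_arity \<Sigma> R = Some ss \<and> list_all2 (has_sort \<Sigma> \<Gamma>) ts ss)"
| "well_formed \<Sigma> \<Gamma> (Eq t u) \<longleftrightarrow> (\<exists>s. has_sort \<Sigma> \<Gamma> t s \<and> has_sort \<Sigma> \<Gamma> u s)"
| "well_formed \<Sigma> \<Gamma> Top \<longleftrightarrow> True"
| "well_formed \<Sigma> \<Gamma> (And \<phi> \<psi>) \<longleftrightarrow> well_formed \<Sigma> \<Gamma> \<phi> \<and> well_formed \<Sigma> \<Gamma> \<psi>"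
| "well_formed \<Sigma> \<Gamma> (Disj I \<psi>) \<longleftrightarrow> (\<forall>i\<in>I. well_formed \<Sigma> \<Gamma> (\<psi> i))"
| "well_formed \<Sigma> \<Gamma> (Ex s \<phi>) \<longleftrightarrow> s \<in> sorts \<Sigma> \<and> well_formed \<Sigma> (s # \<Gamma>) \<phi>"

primrec finitary :: "('i, 's, 'f, 'r) fm \<Rightarrow> bool" where
  "finitary (Rel R ts) \<longleftrightarrow> True"
| "finitary (Eq t u) \<longleftrightarrow> True"
| "finitary Top \<longleftrightarrow> True"
| "finitary (And \<phi> \<psi>) \<longleftrightarrow> finitary \<phi> \<and> finitary \<psi>"
| "finitary (Disj I \<psi>) \<longleftrightarrow> finite I \<and> (\<forall>i\<in>I. finitary (\<psi> i))"
| "finitary (Ex s \<phi>) \<longleftrightarrow> finitary \<phi>"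

definition is_context :: "('s, 'f, 'r) signature \<Rightarrow> 's list \<Rightarrow> bool" where
  "is_context \<Sigma> \<Gamma> \<longleftrightarrow> set \<Gamma> \<subseteq> sorts \<Sigma>"

text \<open>\<open>geometric \<Sigma> \<Gamma> \<phi>\<close>: \<open>{\<Gamma>. \<phi>}\<close> is a geometric formula-in-context over \<open>\<Sigma>\<close>.\<close>

definition geometric ::
  "('s, 'f, 'r) signature \<Rightarrow> 's list \<Rightarrow> ('i, 's, 'f, 'r) fm \<Rightarrow> bool" where
  "geometric \<Sigma> \<Gamma> \<phi> \<longleftrightarrow> is_context \<Sigma> \<Gamma> \<and> well_formed \<Sigma> \<Gamma> \<phi>"

definition coherent ::
  "('s, 'f, 'r) signature \<Rightarrow> 's list \<Rightarrow> ('i, 's, 'f, 'r) fm \<Rightarrow> bool" where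
  "coherent \<Sigma> \<Gamma> \<phi> \<longleftrightarrow> geometric \<Sigma> \<Gamma> \<phi> \<and> finitary \<phi>"

datatype ('i, 's, 'f, 'r) sequent =
  Sequent "('i, 's, 'f, 'r) fm" "'s list" "('i, 's, 'f, 'r) fm"
    ("_ \<turnstile>\<^bsub>_\<^esub> _" [51, 0, 51] 50)

primrec geometric_sequent ::
  "('s, 'f, 'r) signature \<Rightarrow> ('i, 's, 'f, 'r) sequent \<Rightarrow> bool" where
  "geometric_sequent \<Sigma> (\<phi> \<turnstile>\<^bsub>\<Gamma>\<^esub> \<psi>) \<longleftrightarrow> geometric \<Sigma> \<Gamma> \<phi> \<and> geometric \<Sigma> \<Gamma> \<psi>"

primrec coherent_sequent ::
  "('s, 'f, 'r) signature \<Rightarrow> ('i, 's, 'f, 'r) sequent \<Rightarrow> bool" where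
  "coherent_sequent \<Sigma> (\<phi> \<turnstile>\<^bsub>\<Gamma>\<^esub> \<psi>) \<longleftrightarrow> coherent \<Sigma> \<Gamma> \<phi> \<and> coherent \<Sigma> \<Gamma> \<psi>"

definition geometric_theory ::
  "('s, 'f, 'r) signature \<Rightarrow> ('i, 's, 'f, 'r) sequent set \<Rightarrow> bool" where
  "geometric_theory \<Sigma> T \<longleftrightarrow> (\<forall>S\<in>T. geometric_sequent \<Sigma> S)"

definition coherent_theory ::
  "('s, 'f, 'r) signature \<Rightarrow> ('i, 's, 'f, 'r) sequent set \<Rightarrow> bool" where
  "coherent_theory \<Sigma> T \<longleftrightarrow> (\<forall>S\<in>T. coherent_sequent \<Sigma> S)"

primrec subst_tm :: "(nat \<Rightarrow> 'f tm) \<Rightarrow> 'f tm \<Rightarrow> 'f tm" where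
  "subst_tm \<sigma> (Var i) = \<sigma> i"
| "subst_tm \<sigma> (Fn f ts) = Fn f (map (subst_tm \<sigma>) ts)"

definition shift :: "nat \<Rightarrow> 'f tm" where
  "shift i = Var (Suc i)"

definition under_binder :: "(nat \<Rightarrow> 'f tm) \<Rightarrow> nat \<Rightarrow> 'f tm" where
  "under_binder \<sigma> = case_nat (Var 0) (\<lambda>i. subst_tm shift (\<sigma> i))"

primrec subst :: "(nat \<Rightarrow> 'f tm) \<Rightarrow> ('i, 's, 'f, 'r) fm \<Rightarrow> ('i, 's, 'f, 'r) fm" where
  "subst \<sigma> (Rel R ts) = Rel R (map (subst_tm \<sigma>) ts)"
| "subst \<sigma> (Eq t u) = Eq (subst_tm \<sigma> t) (subst_tm \<sigma> u)"
| "subst \<sigma> Top = Top"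
| "subst \<sigma> (And \<phi> \<psi>) = And (subst \<sigma> \<phi>) (subst \<sigma> \<psi>)"
| "subst \<sigma> (Disj I \<psi>) = Disj I (\<lambda>i. subst \<sigma> (\<psi> i))"
| "subst \<sigma> (Ex s \<phi>) = Ex s (subst (under_binder \<sigma>) \<phi>)"

text \<open>
  The sequent calculus of geometric logic, with every sequent geometric over \<open>\<Sigma>\<close>. Contexts are
  explicit, so sorts are not assumed to be inhabited. \<open>subst shift \<phi>\<close> is \<open>\<phi>\<close> regarded in the context
  extended by a fresh variable \<open>Var 0\<close>.
\<close>

inductive provable ::
  "('s, 'f, 'r) signature \<Rightarrow> ('i, 's, 'f, 'r) sequent set \<Rightarrow> ('i, 's, 'f, 'r) sequent \<Rightarrow> bool"
  for \<Sigma> :: "('s, 'f, 'r) signature" and T :: "('i, 's, 'f, 'r) sequent set" where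
  axiom: "S \<in> T \<Longrightarrow> geometric_sequent \<Sigma> S \<Longrightarrow> provable \<Sigma> T S"
| identity: "geometric \<Sigma> \<Gamma> \<phi> \<Longrightarrow> provable \<Sigma> T (\<phi> \<turnstile>\<^bsub>\<Gamma>\<^esub> \<phi>)"
| substitution: "provable \<Sigma> T (\<phi> \<turnstile>\<^bsub>\<Gamma>\<^esub> \<psi>) \<Longrightarrow> is_context \<Sigma> \<Delta> \<Longrightarrow>
    (\<And>i. i < length \<Gamma> \<Longrightarrow> has_sort \<Sigma> \<Delta> (\<sigma> i) (\<Gamma> ! i)) \<Longrightarrow>
    provable \<Sigma> T (subst \<sigma> \<phi> \<turnstile>\<^bsub>\<Delta>\<^esub> subst \<sigma> \<psi>)"
| cut: "provable \<Sigma> T (\<phi> \<turnstile>\<^bsub>\<Gamma>\<^esub> \<psi>) \<Longrightarrow> provable \<Sigma> T (\<psi> \<turnstile>\<^bsub>\<Gamma>\<^esub> \<chi>) \<Longrightarrow> provable \<Sigma> T (\<phi> \<turnstile>\<^bsub>\<Gamma>\<^esub> \<chi>)"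
| eq_refl: "is_context \<Sigma> \<Gamma> \<Longrightarrow> i < length \<Gamma> \<Longrightarrow> provable \<Sigma> T (Top \<turnstile>\<^bsub>\<Gamma>\<^esub> Eq (Var i) (Var i))"
| eq_replace: "geometric \<Sigma> \<Gamma> \<phi> \<Longrightarrow> i < length \<Gamma> \<Longrightarrow> j < length \<Gamma> \<Longrightarrow> \<Gamma> ! i = \<Gamma> ! j \<Longrightarrow>
    provable \<Sigma> T (And (Eq (Var i) (Var j)) \<phi> \<turnstile>\<^bsub>\<Gamma>\<^esub> subst (Var(i := Var j)) \<phi>)"
| top: "geometric \<Sigma> \<Gamma> \<phi> \<Longrightarrow> provable \<Sigma> T (\<phi> \<turnstile>\<^bsub>\<Gamma>\<^esub> Top)"
| and_left1: "geometric \<Sigma> \<Gamma> \<phi> \<Longrightarrow> geometric \<Sigma> \<Gamma> \<psi> \<Longrightarrow> provable \<Sigma> T (And \<phi> \<psi> \<turnstile>\<^bsub>\<Gamma>\<^esub> \<phi>)"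
| and_left2: "geometric \<Sigma> \<Gamma> \<phi> \<Longrightarrow> geometric \<Sigma> \<Gamma> \<psi> \<Longrightarrow> provable \<Sigma> T (And \<phi> \<psi> \<turnstile>\<^bsub>\<Gamma>\<^esub> \<psi>)"
| and_right: "provable \<Sigma> T (\<phi> \<turnstile>\<^bsub>\<Gamma>\<^esub> \<psi>) \<Longrightarrow> provable \<Sigma> T (\<phi> \<turnstile>\<^bsub>\<Gamma>\<^esub> \<chi>) \<Longrightarrow>
    provable \<Sigma> T (\<phi> \<turnstile>\<^bsub>\<Gamma>\<^esub> And \<psi> \<chi>)"
| disj_right: "geometric \<Sigma> \<Gamma> (Disj I \<psi>) \<Longrightarrow> i \<in> I \<Longrightarrow> provable \<Sigma> T (\<psi> i \<turnstile>\<^bsub>\<Gamma>\<^esub> Disj I \<psi>)"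
| disj_left: "geometric \<Sigma> \<Gamma> \<chi> \<Longrightarrow> (\<And>i. i \<in> I \<Longrightarrow> provable \<Sigma> T (\<psi> i \<turnstile>\<^bsub>\<Gamma>\<^esub> \<chi>)) \<Longrightarrow>
    provable \<Sigma> T (Disj I \<psi> \<turnstile>\<^bsub>\<Gamma>\<^esub> \<chi>)"
| distributivity: "geometric \<Sigma> \<Gamma> \<phi> \<Longrightarrow> geometric \<Sigma> \<Gamma> (Disj I \<psi>) \<Longrightarrow>
    provable \<Sigma> T (And \<phi> (Disj I \<psi>) \<turnstile>\<^bsub>\<Gamma>\<^esub> Disj I (\<lambda>i. And \<phi> (\<psi> i)))"
| ex_left: "geometric \<Sigma> \<Gamma> \<psi> \<Longrightarrow> provable \<Sigma> T (\<phi> \<turnstile>\<^bsub>s # \<Gamma>\<^esub> subst shift \<psi>) \<Longrightarrow>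
    provable \<Sigma> T (Ex s \<phi> \<turnstile>\<^bsub>\<Gamma>\<^esub> \<psi>)"
| ex_left_inverse: "provable \<Sigma> T (Ex s \<phi> \<turnstile>\<^bsub>\<Gamma>\<^esub> \<psi>) \<Longrightarrow>
    provable \<Sigma> T (\<phi> \<turnstile>\<^bsub>s # \<Gamma>\<^esub> subst shift \<psi>)"
| frobenius: "geometric \<Sigma> \<Gamma> \<phi> \<Longrightarrow> geometric \<Sigma> \<Gamma> (Ex s \<psi>) \<Longrightarrow>
    provable \<Sigma> T (And \<phi> (Ex s \<psi>) \<turnstile>\<^bsub>\<Gamma>\<^esub> Ex s (And (subst shift \<phi>) \<psi>))"

definition equivalent_to_coherent_theory ::
  "('s, 'f, 'r) signature \<Rightarrow> ('i, 's, 'f, 'r) sequent set \<Rightarrow> bool" where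
  "equivalent_to_coherent_theory \<Sigma> T \<longleftrightarrow>
     (\<exists>T'. coherent_theory \<Sigma> T' \<and>
        (\<forall>S. geometric_sequent \<Sigma> S \<longrightarrow> (provable \<Sigma> T' S \<longleftrightarrow> provable \<Sigma> T S)))"

end

theory Submission
  imports Defs
begin

text \<open>
  Replacing every disjunction in a geometric formula \<open>\<phi>\<close> by a finite subdisjunction, hereditarily,
  yields coherent formulae that entail \<open>\<phi>\<close>, its approximants; they are directed under entailment, and
  \<open>\<phi>\<close> is equivalent to a disjunction of some of them. By induction on derivations, over a coherent
  theory \<open>\<phi> \<turnstile> \<psi>\<close> implies that each approximant of \<open>\<phi>\<close> entails an approximant of \<open>\<psi>\<close>. Since a coherent
  formula approximates itself, this is the compactness property. Conversely, given compactness, the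
  coherent consequences of the theory prove \<open>\<phi> \<turnstile> \<psi>\<close>: write both sides as disjunctions of coherent
  formulae; each disjunct on the left entails a finite disjunction of those on the right.
\<close>

section \<open>Derivability\<close>

lemma geometric_simps:
  "geometric \<Sigma> \<Gamma> Top \<longleftrightarrow> is_context \<Sigma> \<Gamma>"
  "geometric \<Sigma> \<Gamma> (And \<phi> \<psi>) \<longleftrightarrow> geometric \<Sigma> \<Gamma> \<phi> \<and> geometric \<Sigma> \<Gamma> \<psi>"
  "geometric \<Sigma> \<Gamma> (Disj I \<chi>) \<longleftrightarrow> is_context \<Sigma> \<Gamma> \<and> (\<forall>i\<in>I. geometric \<Sigma> \<Gamma> (\<chi> i))"
  "geometric \<Sigma> \<Gamma> (Ex s \<phi>) \<longleftrightarrow> geometric \<Sigma> (s # \<Gamma>) \<phi>"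
  by (auto simp: geometric_def is_context_def)

lemma geometric_is_context: "geometric \<Sigma> \<Gamma> \<phi> \<Longrightarrow> is_context \<Sigma> \<Gamma>"
  by (simp add: geometric_def)

section \<open>Sorts and well-formedness under substitution\<close>

lemma has_sort_subst:
  assumes "has_sort \<Sigma> \<Gamma> t s" and "\<And>i. i < length \<Gamma> \<Longrightarrow> has_sort \<Sigma> \<Delta> (\<sigma> i) (\<Gamma> ! i)"
  shows "has_sort \<Sigma> \<Delta> (subst_tm \<sigma> t) s"
  using assms
proof (induction rule: has_sort.induct)
  case (Fn f ss s ts)
  have "list_all2 (has_sort \<Sigma> \<Delta>) (map (subst_tm \<sigma>) ts) ss"
    using Fn by (auto simp: list_all2_conv_all_nth)
  with Fn.hyps show ?case
    by (auto intro: has_sort.Fn)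
qed simp

lemma has_sort_shift: "has_sort \<Sigma> \<Gamma> t s \<Longrightarrow> has_sort \<Sigma> (r # \<Gamma>) (subst_tm shift t) s"
  by (erule has_sort_subst) (use has_sort.Var[of "Suc _" "r # \<Gamma>" \<Sigma>] in \<open>simp add: shift_def\<close>)

lemma has_sort_under_binder:
  assumes "\<And>i. i < length \<Gamma> \<Longrightarrow> has_sort \<Sigma> \<Delta> (\<sigma> i) (\<Gamma> ! i)" and "i < length (s # \<Gamma>)"
  shows "has_sort \<Sigma> (s # \<Delta>) (under_binder \<sigma> i) ((s # \<Gamma>) ! i)"
  using assms has_sort.Var[of 0 "s # \<Delta>" \<Sigma>]
  by (cases i) (auto simp: under_binder_def intro: has_sort_shift)

lemma well_formed_subst:
  assumes "well_formed \<Sigma> \<Gamma> \<phi>" and "\<And>i. i < length \<Gamma> \<Longrightarrow> has_sort \<Sigma> \<Delta> (\<sigma> i) (\<Gamma> ! i)"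
  shows "well_formed \<Sigma> \<Delta> (subst \<sigma> \<phi>)"
  using assms
proof (induction \<phi> arbitrary: \<Gamma> \<Delta> \<sigma>)
  case (Rel R ts)
  then obtain ss where "rel_arity \<Sigma> R = Some ss" "list_all2 (has_sort \<Sigma> \<Gamma>) ts ss"
    by auto
  moreover from this(2) have "list_all2 (has_sort \<Sigma> \<Delta>) (map (subst_tm \<sigma>) ts) ss"
    unfolding list_all2_map1 by (rule list_all2_mono) (rule has_sort_subst[OF _ Rel.prems(2)])
  ultimately show ?case by simp
next
  case (Eq t u)
  then show ?case by (auto intro: has_sort_subst)
next
  case (And \<phi> \<psi>)
  then show ?case by simp blast
next
  case (Disj I \<psi>)
  then show ?case by simp blast
next
  case (Ex s \<phi>)
  show ?case
    using Ex.prems(1) Ex.IH[of "s # \<Gamma>" "s # \<Delta>" "under_binder \<sigma>"]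
      has_sort_under_binder[OF Ex.prems(2)] by simp
qed simp

lemma geometric_subst:
  assumes "geometric \<Sigma> \<Gamma> \<phi>" "is_context \<Sigma> \<Delta>"
    and "\<And>i. i < length \<Gamma> \<Longrightarrow> has_sort \<Sigma> \<Delta> (\<sigma> i) (\<Gamma> ! i)"
  shows "geometric \<Sigma> \<Delta> (subst \<sigma> \<phi>)"
  using assms by (auto simp: geometric_def intro: well_formed_subst)

lemma geometric_shift:
  assumes "geometric \<Sigma> \<Gamma> \<phi>" "is_context \<Sigma> (s # \<Gamma>)"
  shows "geometric \<Sigma> (s # \<Gamma>) (subst shift \<phi>)"
  using assms(1,2)
  by (rule geometric_subst) (use has_sort.Var[of "Suc _" "s # \<Gamma>" \<Sigma>] in \<open>simp add: shift_def\<close>)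

text \<open>Each rule either carries well-formedness as a side condition or inherits it from its
  premises. Later proofs use this to recover side conditions from a derivation alone.\<close>

lemma provable_geometric: "provable \<Sigma> T S \<Longrightarrow> geometric_sequent \<Sigma> S"
proof (induction rule: provable.induct)
  case (substitution \<phi> \<Gamma> \<psi> \<Delta> \<sigma>)
  then show ?case by (auto intro: geometric_subst)
next
  case (eq_refl \<Gamma> i)
  then show ?case by (auto simp: geometric_def intro: has_sort.Var)
next
  case (eq_replace \<Gamma> \<phi> i j)
  \<comment> \<open>At \<open>k = i\<close> the substitution returns \<open>Var j\<close>, which has
    the right sort because \<open>\<Gamma> ! i = \<Gamma> ! j\<close>.\<close>
  have "has_sort \<Sigma> \<Gamma> ((Var(i := Var j)) k) (\<Gamma> ! k)" if "k < length \<Gamma>" for k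
    using that eq_replace by (auto intro: has_sort.Var)
  then have "geometric \<Sigma> \<Gamma> (subst (Var(i := Var j)) \<phi>)"
    using eq_replace by (blast intro: geometric_subst geometric_is_context)
  moreover have "geometric \<Sigma> \<Gamma> (Eq (Var i) (Var j))"
    using eq_replace has_sort.Var[of i \<Gamma> \<Sigma>] has_sort.Var[of j \<Gamma> \<Sigma>]
    by (auto simp: geometric_def)
  ultimately show ?case using eq_replace by (simp add: geometric_simps)
next
  case (ex_left_inverse s \<phi> \<Gamma> \<psi>)
  then show ?case
    by (auto simp: geometric_simps intro: geometric_shift geometric_is_context)
next
  case (frobenius \<Gamma> \<phi> s \<psi>)
  then show ?case
    by (auto simp: geometric_simps intro: geometric_shift geometric_is_context)
qed (auto simp: geometric_simps dest: geometric_is_context)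

text \<open>Only the rule \<open>axiom\<close> refers to the theory, so a derivation is rebuilt over
  \<open>T'\<close> by replacing each use of an axiom by its derivation there.\<close>

lemma provable_mono:
  assumes "provable \<Sigma> T S" and "\<And>S. S \<in> T \<Longrightarrow> provable \<Sigma> T' S"
  shows "provable \<Sigma> T' S"
  using assms(1)
proof (induction rule: provable.induct)
  case (axiom S)
  then show ?case by (simp add: assms(2))
next
  case (substitution \<phi> \<Gamma> \<psi> \<Delta> \<sigma>)
  then show ?case by (blast intro: provable.substitution)
next
  case (cut \<phi> \<Gamma> \<psi> \<chi>)
  from cut.IH show ?case by (rule provable.cut)
next
  case (ex_left_inverse s \<phi> \<Gamma> \<psi>)
  from ex_left_inverse.IH show ?case by (rule provable.ex_left_inverse)
qed (blast intro: identity eq_refl eq_replace top and_left1 and_left2 and_right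
  disj_right disj_left distributivity ex_left frobenius)+

section \<open>Derived rules\<close>

lemma provable_and_mono:
  assumes "provable \<Sigma> T (\<phi> \<turnstile>\<^bsub>\<Gamma>\<^esub> \<phi>')" and "provable \<Sigma> T (\<psi> \<turnstile>\<^bsub>\<Gamma>\<^esub> \<psi>')"
  shows "provable \<Sigma> T (And \<phi> \<psi> \<turnstile>\<^bsub>\<Gamma>\<^esub> And \<phi>' \<psi>')"
proof -
  have "geometric \<Sigma> \<Gamma> \<phi>" "geometric \<Sigma> \<Gamma> \<psi>"
    using assms[THEN provable_geometric] by auto
  then show ?thesis
    by (blast intro: and_right cut[OF and_left1 assms(1)] cut[OF and_left2 assms(2)])
qed

lemma provable_disj_right:
  assumes "provable \<Sigma> T (\<phi> \<turnstile>\<^bsub>\<Gamma>\<^esub> \<psi> i)" and "i \<in> I" and "\<And>i. i \<in> I \<Longrightarrow> geometric \<Sigma> \<Gamma> (\<psi> i)"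
  shows "provable \<Sigma> T (\<phi> \<turnstile>\<^bsub>\<Gamma>\<^esub> Disj I \<psi>)"
  using provable_geometric[OF assms(1)] assms(2,3)
  by (intro cut[OF assms(1)] disj_right) (auto simp: geometric_simps dest: geometric_is_context)

lemma provable_disj_mono:
  assumes "is_context \<Sigma> \<Gamma>" and "I \<subseteq> J"
    and "\<And>i. i \<in> I \<Longrightarrow> provable \<Sigma> T (\<phi> i \<turnstile>\<^bsub>\<Gamma>\<^esub> \<psi> i)" and "\<And>i. i \<in> J \<Longrightarrow> geometric \<Sigma> \<Gamma> (\<psi> i)"
  shows "provable \<Sigma> T (Disj I \<phi> \<turnstile>\<^bsub>\<Gamma>\<^esub> Disj J \<psi>)"
  using assms by (intro disj_left) (auto simp: geometric_simps intro: provable_disj_right)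

text \<open>Geometric logic has no implication with which to move \<open>\<phi>\<close> to the
  right, so case distinction under a side assumption has to come from
  \<open>distributivity\<close>.\<close>

lemma provable_and_disj_left:
  assumes "geometric \<Sigma> \<Gamma> \<phi>" and "geometric \<Sigma> \<Gamma> (Disj I \<psi>)" and "geometric \<Sigma> \<Gamma> \<chi>"
    and "\<And>i. i \<in> I \<Longrightarrow> provable \<Sigma> T (And \<phi> (\<psi> i) \<turnstile>\<^bsub>\<Gamma>\<^esub> \<chi>)"
  shows "provable \<Sigma> T (And \<phi> (Disj I \<psi>) \<turnstile>\<^bsub>\<Gamma>\<^esub> \<chi>)"
  using assms by (intro cut[OF distributivity disj_left])

lemma provable_and_commute:
  assumes "geometric \<Sigma> \<Gamma> \<phi>" and "geometric \<Sigma> \<Gamma> \<psi>"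
  shows "provable \<Sigma> T (And \<phi> \<psi> \<turnstile>\<^bsub>\<Gamma>\<^esub> And \<psi> \<phi>)"
  using assms by (blast intro: and_right and_left1 and_left2)

text \<open>The calculus has no separate right rule for \<open>Ex\<close>; it arises by reading the
  two-way quantifier rule backwards from an identity sequent. The witness is the new variable
  \<open>Var 0\<close>.\<close>

lemma provable_ex_right:
  assumes "geometric \<Sigma> (s # \<Gamma>) \<phi>"
  shows "provable \<Sigma> T (\<phi> \<turnstile>\<^bsub>s # \<Gamma>\<^esub> subst shift (Ex s \<phi>))"
  using assms by (intro ex_left_inverse identity) (simp add: geometric_simps)

lemma provable_ex_mono:
  assumes "provable \<Sigma> T (\<phi> \<turnstile>\<^bsub>s # \<Gamma>\<^esub> \<psi>)"
  shows "provable \<Sigma> T (Ex s \<phi> \<turnstile>\<^bsub>\<Gamma>\<^esub> Ex s \<psi>)"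
  using provable_geometric[OF assms]
  by (intro ex_left cut[OF assms] provable_ex_right) (auto simp: geometric_simps)

section \<open>Approximants\<close>

text \<open>
  Outside the finite index set the family \<open>\<psi>\<close> is kept, although its values there are irrelevant. This
  makes approximants commute with substitution and finitary formulae approximate themselves.
\<close>

primrec approximants :: "('i, 's, 'f, 'r) fm \<Rightarrow> ('i, 's, 'f, 'r) fm set" where
  "approximants (Rel R ts) = {Rel R ts}"
| "approximants (Eq t u) = {Eq t u}"
| "approximants Top = {Top}"
| "approximants (And \<phi> \<psi>) = {And \<alpha> \<beta> | \<alpha> \<beta>. \<alpha> \<in> approximants \<phi> \<and> \<beta> \<in> approximants \<psi>}"
| "approximants (Disj I \<psi>) = {Disj F \<alpha> | F \<alpha>. finite F \<and> F \<subseteq> I \<and>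
     (\<forall>i. if i \<in> F then \<alpha> i \<in> approximants (\<psi> i) else \<alpha> i = \<psi> i)}"
| "approximants (Ex s \<phi>) = {Ex s \<alpha> | \<alpha>. \<alpha> \<in> approximants \<phi>}"

section \<open>Elementary properties of approximants\<close>

lemma finitary_approximant: "\<alpha> \<in> approximants \<phi> \<Longrightarrow> finitary \<alpha>"
  by (induction \<phi> arbitrary: \<alpha>) (force split: if_splits)+

text \<open>For a disjunction take the whole finite index set. This is how statements about
  approximants become statements about coherent formulae themselves.\<close>

lemma approximant_self: "finitary \<phi> \<Longrightarrow> \<phi> \<in> approximants \<phi>"
  by (induction \<phi>) auto

text \<open>Bottom approximates every disjunction, whatever its disjuncts are.\<close>

lemma approximants_nonempty: "\<exists>\<alpha>. \<alpha> \<in> approximants \<phi>"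
  by (induction \<phi>) (auto intro: exI[of _ "{}"])

lemma approximant_disjI:
  assumes "finite F" "F \<subseteq> I" "\<And>i. i \<in> F \<Longrightarrow> \<alpha> i \<in> approximants (\<psi> i)"
  shows "Disj F (\<lambda>i. if i \<in> F then \<alpha> i else \<psi> i) \<in> approximants (Disj I \<psi>)"
  using assms by simp

lemma approximant_disjE:
  assumes "\<alpha> \<in> approximants (Disj I \<psi>)"
  obtains F \<beta> where "\<alpha> = Disj F \<beta>" "finite F" "F \<subseteq> I" "\<And>i. i \<in> F \<Longrightarrow> \<beta> i \<in> approximants (\<psi> i)"
    "\<And>i. i \<notin> F \<Longrightarrow> \<beta> i = \<psi> i"
  using assms by (auto split: if_splits)

lemma geometric_approximant:
  "\<alpha> \<in> approximants \<phi> \<Longrightarrow> geometric \<Sigma> \<Gamma> \<phi> \<Longrightarrow> geometric \<Sigma> \<Gamma> \<alpha>"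
proof (induction \<phi> arbitrary: \<Gamma> \<alpha>)
  case (Disj I \<psi>)
  from Disj.prems(1) obtain F \<beta> where "\<alpha> = Disj F \<beta>" "F \<subseteq> I"
    and "\<And>i. i \<in> F \<Longrightarrow> \<beta> i \<in> approximants (\<psi> i)"
    by (rule approximant_disjE) blast
  moreover have "geometric \<Sigma> \<Gamma> (\<beta> i)" if "i \<in> F" for i
    by (rule Disj.IH[OF rangeI]) (use that calculation Disj.prems(2) in \<open>auto simp: geometric_simps\<close>)
  ultimately show ?case using Disj.prems(2) by (simp add: geometric_simps)
qed (auto simp: geometric_simps)

text \<open>Every connective of geometric logic is monotone for entailment, and a subdisjunction
  entails the full disjunction.\<close>

lemma approximant_entails:
  "\<alpha> \<in> approximants \<phi> \<Longrightarrow> geometric \<Sigma> \<Gamma> \<phi> \<Longrightarrow> provable \<Sigma> T (\<alpha> \<turnstile>\<^bsub>\<Gamma>\<^esub> \<phi>)"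
proof (induction \<phi> arbitrary: \<Gamma> \<alpha>)
  case (Disj I \<psi>)
  from Disj.prems(1) obtain F \<beta> where "\<alpha> = Disj F \<beta>" "F \<subseteq> I"
    and "\<And>i. i \<in> F \<Longrightarrow> \<beta> i \<in> approximants (\<psi> i)"
    by (rule approximant_disjE) blast
  moreover have "provable \<Sigma> T (\<beta> i \<turnstile>\<^bsub>\<Gamma>\<^esub> \<psi> i)" if "i \<in> F" for i
    by (rule Disj.IH[OF rangeI]) (use that calculation Disj.prems(2) in \<open>auto simp: geometric_simps\<close>)
  ultimately show ?case
    using Disj.prems(2) by (auto simp: geometric_simps intro: provable_disj_mono)
qed (auto simp: geometric_simps intro: identity provable_and_mono provable_ex_mono)

text \<open>Substitution changes terms and leaves index sets alone, so it does not interfere with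
  shrinking them. The equality serves the rules that mention substituted formulae:
  \<open>substitution\<close>, \<open>eq_replace\<close> and the quantifier rules with their
  shifts.\<close>

lemma approximants_subst: "approximants (subst \<sigma> \<phi>) = subst \<sigma> ` approximants \<phi>"
proof (induction \<phi> arbitrary: \<sigma>)
  case (Disj I \<psi>)
  show ?case
  proof (intro set_eqI iffI)
    fix \<alpha> assume "\<alpha> \<in> approximants (subst \<sigma> (Disj I \<psi>))"
    then obtain F \<beta> where F: "\<alpha> = Disj F \<beta>" "finite F" "F \<subseteq> I"
      and \<beta>: "\<And>i. i \<in> F \<Longrightarrow> \<beta> i \<in> approximants (subst \<sigma> (\<psi> i))"
      and out: "\<And>i. i \<notin> F \<Longrightarrow> \<beta> i = subst \<sigma> (\<psi> i)"
      unfolding subst.simps by (rule approximant_disjE) (rule that)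
    have "\<forall>i\<in>F. \<exists>\<gamma>. \<gamma> \<in> approximants (\<psi> i) \<and> \<beta> i = subst \<sigma> \<gamma>"
      using \<beta> Disj.IH by blast
    then obtain \<gamma> where \<gamma>: "\<And>i. i \<in> F \<Longrightarrow> \<gamma> i \<in> approximants (\<psi> i) \<and> \<beta> i = subst \<sigma> (\<gamma> i)"
      by metis
    \<comment> \<open>Equality of formulae compares the families at all indices; outside
      \<open>F\<close> both sides are \<open>subst \<sigma> (\<psi> i)\<close>.\<close>
    have "\<alpha> = subst \<sigma> (Disj F (\<lambda>i. if i \<in> F then \<gamma> i else \<psi> i))"
      using F(1) \<gamma> out by auto
    with F \<gamma> show "\<alpha> \<in> subst \<sigma> ` approximants (Disj I \<psi>)"
      by (blast intro: approximant_disjI)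
  next
    fix \<alpha> assume "\<alpha> \<in> subst \<sigma> ` approximants (Disj I \<psi>)"
    then obtain \<beta> where "\<beta> \<in> approximants (Disj I \<psi>)" and \<alpha>: "\<alpha> = subst \<sigma> \<beta>"
      by blast
    from this(1) obtain F \<gamma> where "\<beta> = Disj F \<gamma>" "finite F" "F \<subseteq> I"
      and "\<And>i. i \<in> F \<Longrightarrow> \<gamma> i \<in> approximants (\<psi> i)" "\<And>i. i \<notin> F \<Longrightarrow> \<gamma> i = \<psi> i"
      by (rule approximant_disjE) (rule that)
    then show "\<alpha> \<in> approximants (subst \<sigma> (Disj I \<psi>))"
      using Disj.IH by (simp add: \<alpha>)
  qed
next
  case (And \<phi> \<psi>)
  show ?case unfolding subst.simps approximants.simps And.IH
    by (auto simp: image_def) (metis subst.simps(4))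
next
  case (Ex s \<phi>)
  show ?case unfolding subst.simps approximants.simps Ex.IH
    by (auto simp: image_def)
qed auto

section \<open>Directedness\<close>

text \<open>Upper bounds are built connective by connective. For a disjunction, unite the two finite
  index sets and choose at each index a bound of the approximants occurring there.\<close>

lemma approximants_directed:
  assumes "\<alpha> \<in> approximants \<phi>" and "\<beta> \<in> approximants \<phi>" and "geometric \<Sigma> \<Gamma> \<phi>"
  shows "\<exists>\<gamma>\<in>approximants \<phi>. provable \<Sigma> T (\<alpha> \<turnstile>\<^bsub>\<Gamma>\<^esub> \<gamma>) \<and> provable \<Sigma> T (\<beta> \<turnstile>\<^bsub>\<Gamma>\<^esub> \<gamma>)"
  using assms
proof (induction \<phi> arbitrary: \<Gamma> \<alpha> \<beta>)
  case (And \<phi> \<psi>)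
  from And.prems obtain \<alpha>1 \<alpha>2 \<beta>1 \<beta>2
    where eq: "\<alpha> = And \<alpha>1 \<alpha>2" "\<beta> = And \<beta>1 \<beta>2"
      and mem: "\<alpha>1 \<in> approximants \<phi>" "\<alpha>2 \<in> approximants \<psi>" "\<beta>1 \<in> approximants \<phi>" "\<beta>2 \<in> approximants \<psi>"
    by auto
  have "geometric \<Sigma> \<Gamma> \<phi>" "geometric \<Sigma> \<Gamma> \<psi>"
    using And.prems(3) by (auto simp: geometric_simps)
  with And.IH mem obtain \<gamma>1 \<gamma>2 where
    "\<gamma>1 \<in> approximants \<phi>" "provable \<Sigma> T (\<alpha>1 \<turnstile>\<^bsub>\<Gamma>\<^esub> \<gamma>1)" "provable \<Sigma> T (\<beta>1 \<turnstile>\<^bsub>\<Gamma>\<^esub> \<gamma>1)"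
    "\<gamma>2 \<in> approximants \<psi>" "provable \<Sigma> T (\<alpha>2 \<turnstile>\<^bsub>\<Gamma>\<^esub> \<gamma>2)" "provable \<Sigma> T (\<beta>2 \<turnstile>\<^bsub>\<Gamma>\<^esub> \<gamma>2)"
    by metis
  then show ?case
    by (intro bexI[of _ "And \<gamma>1 \<gamma>2"]) (auto simp: eq intro: provable_and_mono)
next
  case (Disj I \<psi>)
  obtain F \<alpha>' where \<alpha>: "\<alpha> = Disj F \<alpha>'" "finite F" "F \<subseteq> I" "\<And>i. i \<in> F \<Longrightarrow> \<alpha>' i \<in> approximants (\<psi> i)"
    using Disj.prems(1) by (rule approximant_disjE) blast
  obtain G \<beta>' where \<beta>: "\<beta> = Disj G \<beta>'" "finite G" "G \<subseteq> I" "\<And>i. i \<in> G \<Longrightarrow> \<beta>' i \<in> approximants (\<psi> i)"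
    using Disj.prems(2) by (rule approximant_disjE) blast
  have ctxt: "is_context \<Sigma> \<Gamma>" and geo: "\<And>i. i \<in> I \<Longrightarrow> geometric \<Sigma> \<Gamma> (\<psi> i)"
    using Disj.prems(3) by (auto simp: geometric_simps)
  have "\<exists>\<gamma>. \<gamma> \<in> approximants (\<psi> i) \<and> (i \<in> F \<longrightarrow> provable \<Sigma> T (\<alpha>' i \<turnstile>\<^bsub>\<Gamma>\<^esub> \<gamma>)) \<and>
      (i \<in> G \<longrightarrow> provable \<Sigma> T (\<beta>' i \<turnstile>\<^bsub>\<Gamma>\<^esub> \<gamma>))" if "i \<in> F \<union> G" for i
  proof -
    have I: "i \<in> I" using that \<alpha>(3) \<beta>(3) by blast
    \<comment> \<open>An index may lie in only one of \<open>F\<close> and \<open>G\<close>. An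
      arbitrary approximant \<open>\<delta>\<close> then stands in for the missing one, so that the
      induction hypothesis still applies to a pair.\<close>
    obtain \<delta> where \<delta>: "\<delta> \<in> approximants (\<psi> i)" using approximants_nonempty by blast
    define a where "a = (if i \<in> F then \<alpha>' i else \<delta>)"
    define b where "b = (if i \<in> G then \<beta>' i else \<delta>)"
    have "a \<in> approximants (\<psi> i)" "b \<in> approximants (\<psi> i)"
      using \<alpha>(4) \<beta>(4) \<delta> by (auto simp: a_def b_def)
    from Disj.IH[OF rangeI this geo[OF I]] show ?thesis
      by (auto simp: a_def b_def)
  qed
  then obtain \<gamma> where \<gamma>: "\<And>i. i \<in> F \<union> G \<Longrightarrow> \<gamma> i \<in> approximants (\<psi> i)"
    "\<And>i. i \<in> F \<Longrightarrow> provable \<Sigma> T (\<alpha>' i \<turnstile>\<^bsub>\<Gamma>\<^esub> \<gamma> i)" "\<And>i. i \<in> G \<Longrightarrow> provable \<Sigma> T (\<beta>' i \<turnstile>\<^bsub>\<Gamma>\<^esub> \<gamma> i)"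
    by (metis UnI1 UnI2)
  have "geometric \<Sigma> \<Gamma> (\<gamma> i)" if "i \<in> F \<union> G" for i
    using that \<gamma>(1) geo \<alpha>(3) \<beta>(3) by (blast intro: geometric_approximant)
  then have "provable \<Sigma> T (\<alpha> \<turnstile>\<^bsub>\<Gamma>\<^esub> Disj (F \<union> G) (\<lambda>i. if i \<in> F \<union> G then \<gamma> i else \<psi> i))"
    and "provable \<Sigma> T (\<beta> \<turnstile>\<^bsub>\<Gamma>\<^esub> Disj (F \<union> G) (\<lambda>i. if i \<in> F \<union> G then \<gamma> i else \<psi> i))"
    unfolding \<alpha>(1) \<beta>(1) using ctxt \<gamma>(2,3) by (auto intro!: provable_disj_mono)
  moreover have "Disj (F \<union> G) (\<lambda>i. if i \<in> F \<union> G then \<gamma> i else \<psi> i) \<in> approximants (Disj I \<psi>)"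
    using \<alpha> \<beta> \<gamma>(1) by (intro approximant_disjI) auto
  ultimately show ?case by blast
next
  case (Ex s \<phi>)
  from Ex.prems obtain \<alpha>' \<beta>' where eq: "\<alpha> = Ex s \<alpha>'" "\<beta> = Ex s \<beta>'"
    and mem: "\<alpha>' \<in> approximants \<phi>" "\<beta>' \<in> approximants \<phi>" by auto
  have "geometric \<Sigma> (s # \<Gamma>) \<phi>" using Ex.prems(3) by (simp add: geometric_simps)
  from Ex.IH[OF mem this] show ?case
    by (auto simp: eq intro: provable_ex_mono)
qed (auto intro: identity)

text \<open>Directedness iterated over a finite set, with nonemptiness as the base case.\<close>

lemma finite_approximants_bound:
  assumes "finite F" and "\<And>i. i \<in> F \<Longrightarrow> \<alpha> i \<in> approximants \<phi>" and "geometric \<Sigma> \<Gamma> \<phi>"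
  shows "\<exists>\<gamma>\<in>approximants \<phi>. \<forall>i\<in>F. provable \<Sigma> T (\<alpha> i \<turnstile>\<^bsub>\<Gamma>\<^esub> \<gamma>)"
  using assms(1,2)
proof (induction F)
  case empty
  then show ?case using approximants_nonempty by auto
next
  case (insert x F)
  then obtain \<gamma> where \<gamma>: "\<gamma> \<in> approximants \<phi>" "\<forall>i\<in>F. provable \<Sigma> T (\<alpha> i \<turnstile>\<^bsub>\<Gamma>\<^esub> \<gamma>)"
    by auto
  obtain \<delta> where "\<delta> \<in> approximants \<phi>" "provable \<Sigma> T (\<alpha> x \<turnstile>\<^bsub>\<Gamma>\<^esub> \<delta>)" "provable \<Sigma> T (\<gamma> \<turnstile>\<^bsub>\<Gamma>\<^esub> \<delta>)"
    using approximants_directed[OF _ \<gamma>(1) assms(3)] insert.prems by (metis insertI1)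
  with \<gamma> show ?case by (blast intro: cut)
qed

section \<open>Formulae as disjunctions of approximants\<close>

text \<open>An infinite cardinal equals its square. This allows a disjunction over pairs of indices
  to be reindexed by a subset of \<open>'i\<close>.\<close>

lemma infinite_pairing:
  assumes "infinite (UNIV :: 'i set)"
  obtains p :: "'i \<times> 'i \<Rightarrow> 'i" where "inj p"
proof -
  have "\<exists>p :: 'i \<times> 'i \<Rightarrow> 'i. bij_betw p (UNIV \<times> UNIV) UNIV"
    using card_of_Times_same_infinite[OF assms] by (simp only: card_of_ordIso)
  then show ?thesis
    using that by (auto dest: bij_is_inj)
qed

text \<open>Covers atomic formulae and \<open>Top\<close>, which approximate themselves. The
  disjunction is a constant family over \<open>UNIV\<close>, which is nonempty because types
  are.\<close>

lemma entails_disj_singleton: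
  assumes "geometric \<Sigma> \<Gamma> \<phi>" and "\<phi> \<in> approximants \<phi>"
  shows "\<exists>(I :: 'i set) \<alpha>. (\<forall>i\<in>I. \<alpha> i \<in> approximants \<phi>) \<and> provable \<Sigma> T (\<phi> \<turnstile>\<^bsub>\<Gamma>\<^esub> Disj I \<alpha>)"
  using assms by (intro exI[of _ UNIV] exI[of _ "\<lambda>_. \<phi>"])
    (auto intro: provable_disj_right identity)

text \<open>Disjunctions are pulled outwards: through \<open>And\<close> by distributivity, through
  \<open>Disj\<close> by flattening, through \<open>Ex\<close> because existential quantification
  commutes with disjunction. With \<open>approximant_entails\<close> this makes
  \<open>\<phi>\<close> equivalent to the disjunction, over any theory.\<close>

lemma entails_disj_approximants:
  fixes \<phi> :: "('i, 's, 'f, 'r) fm"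
  assumes inf: "infinite (UNIV :: 'i set)" and "geometric \<Sigma> \<Gamma> \<phi>"
  shows "\<exists>(I :: 'i set) \<alpha>. (\<forall>i\<in>I. \<alpha> i \<in> approximants \<phi>) \<and> provable \<Sigma> T (\<phi> \<turnstile>\<^bsub>\<Gamma>\<^esub> Disj I \<alpha>)"
  using assms(2)
proof (induction \<phi> arbitrary: \<Gamma>)
  case (And \<phi> \<psi>)
  obtain p :: "'i \<times> 'i \<Rightarrow> 'i" where p: "inj p" using infinite_pairing[OF inf] .
  have geo: "geometric \<Sigma> \<Gamma> \<phi>" "geometric \<Sigma> \<Gamma> \<psi>"
    using And.prems by (auto simp: geometric_simps)
  obtain I \<alpha> where \<alpha>: "\<And>i. i \<in> I \<Longrightarrow> \<alpha> i \<in> approximants \<phi>" "provable \<Sigma> T (\<phi> \<turnstile>\<^bsub>\<Gamma>\<^esub> Disj I \<alpha>)"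
    using And.IH(1)[OF geo(1)] by blast
  obtain J \<beta> where \<beta>: "\<And>j. j \<in> J \<Longrightarrow> \<beta> j \<in> approximants \<psi>" "provable \<Sigma> T (\<psi> \<turnstile>\<^bsub>\<Gamma>\<^esub> Disj J \<beta>)"
    using And.IH(2)[OF geo(2)] by blast
  have geo_disj: "geometric \<Sigma> \<Gamma> (Disj I \<alpha>)" "geometric \<Sigma> \<Gamma> (Disj J \<beta>)"
    using provable_geometric[OF \<alpha>(2)] provable_geometric[OF \<beta>(2)] by auto
  \<comment> \<open>\<open>\<gamma>\<close> decodes its index into a pair; it matters only on the
    image of \<open>p\<close>.\<close>
  define \<gamma> where "\<gamma> k = (case inv p k of (i, j) \<Rightarrow> And (\<alpha> i) (\<beta> j))" for k
  have \<gamma>: "\<gamma> (p (i, j)) = And (\<alpha> i) (\<beta> j)" for i j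
    by (simp add: \<gamma>_def inv_f_f[OF p])
  let ?K = "p ` (I \<times> J)"
  have geo\<gamma>: "geometric \<Sigma> \<Gamma> (Disj ?K \<gamma>)"
    using geo_disj by (auto simp: \<gamma> geometric_simps)
  have "provable \<Sigma> T (And (\<alpha> i) (\<beta> j) \<turnstile>\<^bsub>\<Gamma>\<^esub> Disj ?K \<gamma>)" if "i \<in> I" "j \<in> J" for i j
    using disj_right[OF geo\<gamma>, of "p (i, j)"] that by (simp add: \<gamma>)
  then have "provable \<Sigma> T (And (\<alpha> i) (Disj J \<beta>) \<turnstile>\<^bsub>\<Gamma>\<^esub> Disj ?K \<gamma>)" if "i \<in> I" for i
    using that geo_disj geo\<gamma> by (intro provable_and_disj_left) (auto simp: geometric_simps)
  \<comment> \<open>Distributivity splits only the right conjunct, so the conjuncts are exchanged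
    before the second splitting and exchanged back after it.\<close>
  then have "provable \<Sigma> T (And (Disj J \<beta>) (\<alpha> i) \<turnstile>\<^bsub>\<Gamma>\<^esub> Disj ?K \<gamma>)" if "i \<in> I" for i
    using that geo_disj by (auto simp: geometric_simps intro: cut[OF provable_and_commute])
  then have "provable \<Sigma> T (And (Disj J \<beta>) (Disj I \<alpha>) \<turnstile>\<^bsub>\<Gamma>\<^esub> Disj ?K \<gamma>)"
    using geo_disj geo\<gamma> by (intro provable_and_disj_left)
  then have "provable \<Sigma> T (And (Disj I \<alpha>) (Disj J \<beta>) \<turnstile>\<^bsub>\<Gamma>\<^esub> Disj ?K \<gamma>)"
    using geo_disj by (blast intro: cut[OF provable_and_commute])
  then have "provable \<Sigma> T (And \<phi> \<psi> \<turnstile>\<^bsub>\<Gamma>\<^esub> Disj ?K \<gamma>)"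
    by (rule cut[OF provable_and_mono[OF \<alpha>(2) \<beta>(2)]])
  moreover have "\<forall>k\<in>?K. \<gamma> k \<in> approximants (And \<phi> \<psi>)"
    using \<alpha>(1) \<beta>(1) by (auto simp: \<gamma>)
  ultimately show ?case by blast
next
  case (Disj I \<psi>)
  obtain p :: "'i \<times> 'i \<Rightarrow> 'i" where p: "inj p" using infinite_pairing[OF inf] .
  have ctxt: "is_context \<Sigma> \<Gamma>" and geo: "\<And>i. i \<in> I \<Longrightarrow> geometric \<Sigma> \<Gamma> (\<psi> i)"
    using Disj.prems by (auto simp: geometric_simps)
  have "\<forall>i\<in>I. \<exists>J \<alpha>. (\<forall>j\<in>J. \<alpha> j \<in> approximants (\<psi> i)) \<and> provable \<Sigma> T (\<psi> i \<turnstile>\<^bsub>\<Gamma>\<^esub> Disj J \<alpha>)"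
    using Disj.IH[OF rangeI geo] by blast
  then obtain J \<alpha> where \<alpha>: "\<And>i j. i \<in> I \<Longrightarrow> j \<in> J i \<Longrightarrow> \<alpha> i j \<in> approximants (\<psi> i)"
    "\<And>i. i \<in> I \<Longrightarrow> provable \<Sigma> T (\<psi> i \<turnstile>\<^bsub>\<Gamma>\<^esub> Disj (J i) (\<alpha> i))"
    by metis
  \<comment> \<open>An approximant of the single disjunct \<open>\<psi> i\<close> has to be wrapped
    in a one-element disjunction over \<open>{i}\<close> to be an approximant of
    \<open>Disj I \<psi>\<close>.\<close>
  define \<gamma> where "\<gamma> k = (case inv p k of (i, j) \<Rightarrow> Disj {i} (\<lambda>l. if l \<in> {i} then \<alpha> i j else \<psi> l))" for k
  have \<gamma>: "\<gamma> (p (i, j)) = Disj {i} (\<lambda>l. if l \<in> {i} then \<alpha> i j else \<psi> l)" for i j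
    by (simp add: \<gamma>_def inv_f_f[OF p])
  let ?K = "p ` Sigma I J"
  have geo\<alpha>: "geometric \<Sigma> \<Gamma> (\<alpha> i j)" if "i \<in> I" "j \<in> J i" for i j
    using that \<alpha>(1) geo by (blast intro: geometric_approximant)
  have geo\<gamma>: "geometric \<Sigma> \<Gamma> (Disj ?K \<gamma>)"
    using geo\<alpha> ctxt by (auto simp: \<gamma> geometric_simps)
  have "provable \<Sigma> T (\<alpha> i j \<turnstile>\<^bsub>\<Gamma>\<^esub> Disj ?K \<gamma>)" if "i \<in> I" "j \<in> J i" for i j
  proof (rule cut)
    show "provable \<Sigma> T (\<alpha> i j \<turnstile>\<^bsub>\<Gamma>\<^esub> \<gamma> (p (i, j)))"
      unfolding \<gamma> using geo\<alpha>[OF that]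
      by (intro provable_disj_right[where i = i]) (auto intro: identity)
    show "provable \<Sigma> T (\<gamma> (p (i, j)) \<turnstile>\<^bsub>\<Gamma>\<^esub> Disj ?K \<gamma>)"
      using that by (intro disj_right geo\<gamma>) auto
  qed
  then have "provable \<Sigma> T (Disj I \<psi> \<turnstile>\<^bsub>\<Gamma>\<^esub> Disj ?K \<gamma>)"
    using geo\<gamma> by (blast intro: disj_left cut[OF \<alpha>(2)])
  moreover have "\<forall>k\<in>?K. \<gamma> k \<in> approximants (Disj I \<psi>)"
    using \<alpha>(1) by (auto simp: \<gamma>)
  ultimately show ?case by blast
next
  case (Ex s \<phi>)
  have "geometric \<Sigma> (s # \<Gamma>) \<phi>" using Ex.prems by (simp add: geometric_simps)
  from Ex.IH[OF this] obtain I \<alpha>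
    where \<alpha>: "\<And>i. i \<in> I \<Longrightarrow> \<alpha> i \<in> approximants \<phi>" "provable \<Sigma> T (\<phi> \<turnstile>\<^bsub>s # \<Gamma>\<^esub> Disj I \<alpha>)"
    by blast
  have geo: "geometric \<Sigma> (s # \<Gamma>) (\<alpha> i)" if "i \<in> I" for i
    using provable_geometric[OF \<alpha>(2)] that by (simp add: geometric_simps)
  have ctxt: "is_context \<Sigma> \<Gamma>" "is_context \<Sigma> (s # \<Gamma>)"
    using Ex.prems by (auto simp: geometric_def is_context_def)
  \<comment> \<open>Shifting commutes with \<open>Disj\<close>, so it is enough that each
    \<open>\<alpha> i\<close> entails the shift of \<open>Ex s (\<alpha> i)\<close>, with the bound
    variable as witness.\<close>
  have "provable \<Sigma> T (Disj I \<alpha> \<turnstile>\<^bsub>s # \<Gamma>\<^esub> subst shift (Disj I (\<lambda>i. Ex s (\<alpha> i))))"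
    unfolding subst.simps(5) using ctxt geo
    by (intro provable_disj_mono provable_ex_right geometric_shift) (auto simp: geometric_simps)
  then have "provable \<Sigma> T (Ex s \<phi> \<turnstile>\<^bsub>\<Gamma>\<^esub> Disj I (\<lambda>i. Ex s (\<alpha> i)))"
    using ctxt geo by (intro ex_left cut[OF \<alpha>(2)]) (auto simp: geometric_simps)
  with \<alpha>(1) show ?case by (intro exI[of _ I] exI[of _ "\<lambda>i. Ex s (\<alpha> i)"]) auto
qed (rule entails_disj_singleton; simp)+

section \<open>Coherent theories\<close>

text \<open>Coherence of \<open>T\<close> enters in the axiom case: the right-hand side of an axiom
  approximates itself. For the other rules, approximants have the same outer shape as the formulae,
  so the rule is applied again to approximants; \<open>disj_left\<close> also needs
  directedness.\<close>

lemma approximant_provable: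
  assumes "coherent_theory \<Sigma> T" and "provable \<Sigma> T (\<phi> \<turnstile>\<^bsub>\<Gamma>\<^esub> \<psi>)" and "\<alpha> \<in> approximants \<phi>"
  shows "\<exists>\<beta>\<in>approximants \<psi>. provable \<Sigma> T (\<alpha> \<turnstile>\<^bsub>\<Gamma>\<^esub> \<beta>)"
  using assms(2,3)
proof (induction "\<phi> \<turnstile>\<^bsub>\<Gamma>\<^esub> \<psi>" arbitrary: \<phi> \<Gamma> \<psi> \<alpha> rule: provable.induct)
  case (axiom \<phi> \<Gamma> \<psi>)
  have "coherent \<Sigma> \<Gamma> \<phi>" "coherent \<Sigma> \<Gamma> \<psi>"
    using assms(1) axiom(1) unfolding coherent_theory_def by (metis coherent_sequent.simps)+
  then have "geometric \<Sigma> \<Gamma> \<phi>" "\<psi> \<in> approximants \<psi>"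
    by (auto simp: coherent_def intro: approximant_self)
  with axiom show ?case
    by (blast intro: cut[OF approximant_entails] provable.axiom)
next
  case (identity \<Gamma> \<phi>)
  then show ?case by (blast intro: provable.identity geometric_approximant)
next
  case (substitution \<phi> \<Gamma> \<psi> \<Delta> \<sigma>)
  from substitution.prems obtain \<alpha>' where \<alpha>': "\<alpha>' \<in> approximants \<phi>" "\<alpha> = subst \<sigma> \<alpha>'"
    unfolding approximants_subst by blast
  from substitution.hyps(2)[OF \<alpha>'(1)] obtain \<beta>
    where "\<beta> \<in> approximants \<psi>" "provable \<Sigma> T (\<alpha>' \<turnstile>\<^bsub>\<Gamma>\<^esub> \<beta>)" by blast
  then show ?case
    unfolding approximants_subst \<alpha>'(2)
    by (blast intro: provable.substitution substitution.hyps(3,4))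
next
  case (cut \<phi> \<Gamma> \<psi> \<chi>)
  then obtain \<beta> where "\<beta> \<in> approximants \<psi>" "provable \<Sigma> T (\<alpha> \<turnstile>\<^bsub>\<Gamma>\<^esub> \<beta>)" by blast
  moreover from this(1) cut.hyps(4) obtain \<gamma>
    where "\<gamma> \<in> approximants \<chi>" "provable \<Sigma> T (\<beta> \<turnstile>\<^bsub>\<Gamma>\<^esub> \<gamma>)" by blast
  ultimately show ?case by (blast intro: provable.cut)
next
  case (eq_refl \<Gamma> i)
  then show ?case by (auto intro: provable.eq_refl)
next
  case (eq_replace \<Gamma> \<phi> i j)
  from eq_replace.prems obtain \<alpha>'
    where "\<alpha>' \<in> approximants \<phi>" "\<alpha> = And (Eq (Var i) (Var j)) \<alpha>'"
    by auto
  with eq_replace.hyps show ?case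
    unfolding approximants_subst by (blast intro: provable.eq_replace geometric_approximant)
next
  case (top \<Gamma> \<phi>)
  then show ?case by (auto intro: provable.top geometric_approximant)
next
  case (and_left1 \<Gamma> \<phi> \<psi>)
  then show ?case by (auto intro: provable.and_left1 geometric_approximant)
next
  case (and_left2 \<Gamma> \<phi> \<psi>)
  then show ?case by (auto intro: provable.and_left2 geometric_approximant)
next
  case (and_right \<phi> \<Gamma> \<psi> \<chi>)
  then obtain \<beta> \<gamma> where "\<beta> \<in> approximants \<psi>" "provable \<Sigma> T (\<alpha> \<turnstile>\<^bsub>\<Gamma>\<^esub> \<beta>)"
    "\<gamma> \<in> approximants \<chi>" "provable \<Sigma> T (\<alpha> \<turnstile>\<^bsub>\<Gamma>\<^esub> \<gamma>)"
    by metis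
  then show ?case
    by (intro bexI[of _ "And \<beta> \<gamma>"]) (auto intro: provable.and_right)
next
  case (disj_right \<Gamma> I \<psi> i)
  have "geometric \<Sigma> \<Gamma> \<alpha>"
    using disj_right by (auto simp: geometric_simps intro: geometric_approximant)
  \<comment> \<open>The approximant of the full disjunction keeps only the index
    \<open>i\<close>.\<close>
  then have "provable \<Sigma> T (\<alpha> \<turnstile>\<^bsub>\<Gamma>\<^esub> Disj {i} (\<lambda>j. if j \<in> {i} then \<alpha> else \<psi> j))"
    by (intro provable_disj_right[where i = i]) (auto intro: provable.identity)
  moreover have "Disj {i} (\<lambda>j. if j \<in> {i} then \<alpha> else \<psi> j) \<in> approximants (Disj I \<psi>)"
    using disj_right by (intro approximant_disjI) auto
  ultimately show ?case by blast
next
  case (disj_left \<Gamma> \<chi> I \<psi>)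
  obtain F \<beta> where \<alpha>: "\<alpha> = Disj F \<beta>" and F: "finite F" "F \<subseteq> I"
    and \<beta>: "\<And>i. i \<in> F \<Longrightarrow> \<beta> i \<in> approximants (\<psi> i)"
    using disj_left.prems by (rule approximant_disjE) blast
  have "\<forall>i\<in>F. \<exists>\<gamma>. \<gamma> \<in> approximants \<chi> \<and> provable \<Sigma> T (\<beta> i \<turnstile>\<^bsub>\<Gamma>\<^esub> \<gamma>)"
    using disj_left.hyps(3) F(2) \<beta> by blast
  then obtain \<gamma> where \<gamma>: "\<And>i. i \<in> F \<Longrightarrow> \<gamma> i \<in> approximants \<chi>"
    "\<And>i. i \<in> F \<Longrightarrow> provable \<Sigma> T (\<beta> i \<turnstile>\<^bsub>\<Gamma>\<^esub> \<gamma> i)"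
    by metis
  \<comment> \<open>Different disjuncts may entail different approximants of \<open>\<chi>\<close>.
    Since \<open>F\<close> is finite, these have a common bound.\<close>
  obtain \<delta> where \<delta>: "\<delta> \<in> approximants \<chi>" "\<And>i. i \<in> F \<Longrightarrow> provable \<Sigma> T (\<gamma> i \<turnstile>\<^bsub>\<Gamma>\<^esub> \<delta>)"
    using finite_approximants_bound[where \<alpha> = \<gamma>, OF F(1) \<gamma>(1) disj_left.hyps(1)] by blast
  have "geometric \<Sigma> \<Gamma> \<delta>"
    using \<delta>(1) disj_left.hyps(1) by (rule geometric_approximant)
  then have "provable \<Sigma> T (\<alpha> \<turnstile>\<^bsub>\<Gamma>\<^esub> \<delta>)"
    unfolding \<alpha> by (blast intro: provable.disj_left provable.cut[OF \<gamma>(2) \<delta>(2)])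
  with \<delta>(1) show ?case by blast
next
  case (distributivity \<Gamma> \<phi> I \<psi>)
  obtain \<alpha>' \<alpha>'' where \<alpha>: "\<alpha> = And \<alpha>' \<alpha>''" "\<alpha>' \<in> approximants \<phi>"
    and "\<alpha>'' \<in> approximants (Disj I \<psi>)"
    using distributivity.prems by auto
  from this(3) obtain F \<beta> where \<alpha>'': "\<alpha>'' = Disj F \<beta>" and F: "finite F" "F \<subseteq> I"
    and \<beta>: "\<And>i. i \<in> F \<Longrightarrow> \<beta> i \<in> approximants (\<psi> i)"
    by (rule approximant_disjE) blast
  have geo: "geometric \<Sigma> \<Gamma> \<alpha>'" "geometric \<Sigma> \<Gamma> (Disj F \<beta>)" "is_context \<Sigma> \<Gamma>"
    using distributivity.hyps F \<beta> \<alpha>(2)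
    by (auto simp: geometric_simps intro: geometric_approximant)
  \<comment> \<open>Outside \<open>F\<close> the family must be that of the target disjunction,
    namely \<open>And \<phi> (\<psi> i)\<close>.\<close>
  let ?\<delta> = "Disj F (\<lambda>i. if i \<in> F then And \<alpha>' (\<beta> i) else And \<phi> (\<psi> i))"
  have "provable \<Sigma> T (And \<alpha>' (\<beta> i) \<turnstile>\<^bsub>\<Gamma>\<^esub> ?\<delta>)" if "i \<in> F" for i
    using that geo
    by (intro provable_disj_right[where i = i]) (auto simp: geometric_simps intro: provable.identity)
  then have "provable \<Sigma> T (\<alpha> \<turnstile>\<^bsub>\<Gamma>\<^esub> ?\<delta>)"
    unfolding \<alpha>(1) \<alpha>'' using geo
    by (intro provable_and_disj_left) (auto simp: geometric_simps)
  moreover have "?\<delta> \<in> approximants (Disj I (\<lambda>i. And \<phi> (\<psi> i)))"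
    using F \<beta> \<alpha>(2) by (intro approximant_disjI) auto
  ultimately show ?case by blast
next
  case (ex_left \<Gamma> \<psi> \<phi> s)
  from ex_left.prems obtain \<alpha>' where \<alpha>: "\<alpha> = Ex s \<alpha>'" "\<alpha>' \<in> approximants \<phi>" by auto
  \<comment> \<open>An approximant of the shifted \<open>\<psi>\<close> is itself the shift of some
    \<open>\<beta>\<close>, hence independent of the new variable, and \<open>ex_left\<close>
    remains applicable.\<close>
  obtain \<beta> where \<beta>: "\<beta> \<in> approximants \<psi>" "provable \<Sigma> T (\<alpha>' \<turnstile>\<^bsub>s # \<Gamma>\<^esub> subst shift \<beta>)"
    using ex_left.hyps(3)[OF \<alpha>(2)] unfolding approximants_subst by blast
  from \<beta>(1) ex_left.hyps(1) have "geometric \<Sigma> \<Gamma> \<beta>" by (rule geometric_approximant)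
  then have "provable \<Sigma> T (\<alpha> \<turnstile>\<^bsub>\<Gamma>\<^esub> \<beta>)"
    unfolding \<alpha>(1) using \<beta>(2) by (rule provable.ex_left)
  with \<beta>(1) show ?case by blast
next
  case (ex_left_inverse s \<phi> \<Gamma> \<psi>)
  have "Ex s \<alpha> \<in> approximants (Ex s \<phi>)" using ex_left_inverse.prems by simp
  from ex_left_inverse.hyps(2)[OF this] obtain \<beta>
    where "\<beta> \<in> approximants \<psi>" "provable \<Sigma> T (Ex s \<alpha> \<turnstile>\<^bsub>\<Gamma>\<^esub> \<beta>)" by blast
  then show ?case unfolding approximants_subst by (blast intro: provable.ex_left_inverse)
next
  case (frobenius \<Gamma> \<phi> s \<psi>)
  obtain \<alpha>' \<beta> where \<alpha>: "\<alpha> = And \<alpha>' (Ex s \<beta>)" "\<alpha>' \<in> approximants \<phi>" "\<beta> \<in> approximants \<psi>"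
    using frobenius.prems by auto
  then have "provable \<Sigma> T (\<alpha> \<turnstile>\<^bsub>\<Gamma>\<^esub> Ex s (And (subst shift \<alpha>') \<beta>))"
    using frobenius.hyps
    by (auto intro!: provable.frobenius simp: geometric_simps intro: geometric_approximant)
  moreover have "Ex s (And (subst shift \<alpha>') \<beta>) \<in> approximants (Ex s (And (subst shift \<phi>) \<psi>))"
    using \<alpha> by (simp add: approximants_subst)
  ultimately show ?case by blast
qed

text \<open>As \<open>\<phi>\<close> approximates itself, it entails an approximant of the
  disjunction. This is a disjunction over a finite \<open>F\<close>, and each of its disjuncts
  entails the corresponding \<open>\<psi> i\<close>.\<close>

lemma coherent_theory_compact:
  assumes "coherent_theory \<Sigma> T" and "coherent \<Sigma> \<Gamma> \<phi>" and "provable \<Sigma> T (\<phi> \<turnstile>\<^bsub>\<Gamma>\<^esub> Disj I \<psi>)"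
  shows "\<exists>F. finite F \<and> F \<subseteq> I \<and> provable \<Sigma> T (\<phi> \<turnstile>\<^bsub>\<Gamma>\<^esub> Disj F \<psi>)"
proof -
  have "\<phi> \<in> approximants \<phi>"
    using assms(2) by (simp add: coherent_def approximant_self)
  then obtain \<beta> where \<beta>: "\<beta> \<in> approximants (Disj I \<psi>)" "provable \<Sigma> T (\<phi> \<turnstile>\<^bsub>\<Gamma>\<^esub> \<beta>)"
    using approximant_provable[OF assms(1,3)] by blast
  obtain F \<gamma> where F: "\<beta> = Disj F \<gamma>" "finite F" "F \<subseteq> I" "\<And>i. i \<in> F \<Longrightarrow> \<gamma> i \<in> approximants (\<psi> i)"
    using \<beta>(1) by (rule approximant_disjE) blast
  have "geometric \<Sigma> \<Gamma> (Disj I \<psi>)"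
    using provable_geometric[OF assms(3)] by simp
  then have "provable \<Sigma> T (\<beta> \<turnstile>\<^bsub>\<Gamma>\<^esub> Disj F \<psi>)"
    unfolding F(1) using F(3,4)
    by (intro provable_disj_mono approximant_entails) (auto simp: geometric_simps)
  with \<beta>(2) F show ?thesis by (blast intro: cut)
qed

section \<open>The compactness criterion for coherent axiomatizability\<close>

theorem theorem3p5:
  fixes \<Sigma> :: "('s, 'f, 'r) signature"
    and T :: "('i, 's, 'f, 'r) sequent set"
  assumes "infinite (UNIV :: 'i set)"
    and "is_signature \<Sigma>"
    and "geometric_theory \<Sigma> T"
  shows "equivalent_to_coherent_theory \<Sigma> T \<longleftrightarrow>
    (\<forall>\<Gamma> \<phi> (I :: 'i set) \<psi>.
       coherent \<Sigma> \<Gamma> \<phi> \<longrightarrow> (\<forall>i\<in>I. geometric \<Sigma> \<Gamma> (\<psi> i)) \<longrightarrow>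
       provable \<Sigma> T (\<phi> \<turnstile>\<^bsub>\<Gamma>\<^esub> Disj I \<psi>) \<longrightarrow>
       (\<exists>I'. finite I' \<and> I' \<subseteq> I \<and> provable \<Sigma> T (\<phi> \<turnstile>\<^bsub>\<Gamma>\<^esub> Disj I' \<psi>)))"
    (is "_ \<longleftrightarrow> ?compact")
proof
  assume "equivalent_to_coherent_theory \<Sigma> T"
  then obtain T' where T': "coherent_theory \<Sigma> T'"
    and eq: "\<And>S. geometric_sequent \<Sigma> S \<Longrightarrow> provable \<Sigma> T' S \<longleftrightarrow> provable \<Sigma> T S"
    unfolding equivalent_to_coherent_theory_def by blast
  show ?compact
    using coherent_theory_compact[OF T'] eq provable_geometric by metis
next
  assume compact: ?compact
  \<comment> \<open>The candidate axiomatization consists of all coherent consequences of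
    \<open>T\<close>.\<close>
  define T' where "T' = {S. coherent_sequent \<Sigma> S \<and> provable \<Sigma> T S}"
  have "provable \<Sigma> T' S" if S_provable: "provable \<Sigma> T S" for S
  proof (cases S)
    case S: (Sequent \<phi> \<Gamma> \<psi>)
    have geo: "geometric \<Sigma> \<Gamma> \<phi>" "geometric \<Sigma> \<Gamma> \<psi>"
      using provable_geometric[OF that] by (auto simp: S)
    \<comment> \<open>The left-hand side is decomposed over \<open>T'\<close>, where the final
      derivation takes place; the right-hand side is decomposed over \<open>T\<close>, where
      compactness is available.\<close>
    obtain I \<alpha> where \<alpha>: "\<And>i. i \<in> I \<Longrightarrow> \<alpha> i \<in> approximants \<phi>" "provable \<Sigma> T' (\<phi> \<turnstile>\<^bsub>\<Gamma>\<^esub> Disj I \<alpha>)"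
      using entails_disj_approximants[where T = T', OF assms(1) geo(1)] by blast
    obtain J \<beta> where \<beta>: "\<And>j. j \<in> J \<Longrightarrow> \<beta> j \<in> approximants \<psi>" "provable \<Sigma> T (\<psi> \<turnstile>\<^bsub>\<Gamma>\<^esub> Disj J \<beta>)"
      using entails_disj_approximants[where T = T, OF assms(1) geo(2)] by blast
    have geo\<beta>: "\<And>j. j \<in> J \<Longrightarrow> geometric \<Sigma> \<Gamma> (\<beta> j)"
      using \<beta>(1) geo(2) by (blast intro: geometric_approximant)
    have "provable \<Sigma> T' (\<alpha> i \<turnstile>\<^bsub>\<Gamma>\<^esub> \<psi>)" if i: "i \<in> I" for i
    proof -
      have coh: "coherent \<Sigma> \<Gamma> (\<alpha> i)"
        using \<alpha>(1)[OF i] geo(1)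
        by (auto simp: coherent_def intro: geometric_approximant finitary_approximant)
      have "provable \<Sigma> T (\<alpha> i \<turnstile>\<^bsub>\<Gamma>\<^esub> Disj J \<beta>)"
        using approximant_entails[OF \<alpha>(1)[OF i] geo(1)] cut[OF S_provable[unfolded S] \<beta>(2)] by (rule cut)
      with compact[rule_format, OF coh] geo\<beta> obtain F
        where F: "finite F" "F \<subseteq> J" "provable \<Sigma> T (\<alpha> i \<turnstile>\<^bsub>\<Gamma>\<^esub> Disj F \<beta>)"
        by metis
      have coh\<beta>: "coherent \<Sigma> \<Gamma> (Disj F \<beta>)"
        using F \<beta>(1) geo\<beta> geometric_is_context[OF geo(1)]
        by (auto simp: coherent_def geometric_simps intro: finitary_approximant)
      \<comment> \<open>After the passage to the finite \<open>F\<close> both sides are coherent, so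
        the sequent is an axiom of \<open>T'\<close>.\<close>
      have "provable \<Sigma> T' (\<alpha> i \<turnstile>\<^bsub>\<Gamma>\<^esub> Disj F \<beta>)"
        using coh coh\<beta> F(3) by (intro axiom) (auto simp: T'_def coherent_def)
      \<comment> \<open>Approximants entail their formula over every theory, so the way back to
        \<open>\<psi>\<close> is open in \<open>T'\<close>.\<close>
      moreover have "provable \<Sigma> T' (Disj F \<beta> \<turnstile>\<^bsub>\<Gamma>\<^esub> \<psi>)"
        using F(2) \<beta>(1) geo(2) by (blast intro: disj_left approximant_entails)
      ultimately show ?thesis by (rule cut)
    qed
    then show ?thesis
      unfolding S using geo(2) by (blast intro: cut[OF \<alpha>(2)] disj_left)
  qed
  moreover have "provable \<Sigma> T S" if "provable \<Sigma> T' S" for S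
    using that by (rule provable_mono) (simp add: T'_def)
  moreover have "coherent_theory \<Sigma> T'"
    by (simp add: T'_def coherent_theory_def)
  ultimately show "equivalent_to_coherent_theory \<Sigma> T"
    unfolding equivalent_to_coherent_theory_def by blast
qed

end
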